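(* Let $k>1$ be an integer and let $\mathcal{X}=(\Omega,S)$ be a two-valenced association scheme whose basis relations have valencies $1$ and $k$ (a $\{1,k\}$-scheme). Assume that $\mathcal{X}$ is saturated and Desarguesian. Then $\mathcal{X}$ is schurian and separable.
   Context: An association scheme on a finite set $\Omega$ is a pair $\mathcal{X}=(\Omega,S)$ where $S$ is a partition of $\Omega\times\Omega$ such that the diagonal $1_\Omega\in S$, $S^*=S$ (where $r^*=\{(\beta,\alpha):(\alpha,\beta)\in r\}$), and for all $r,s,t\in S$ the number $c_{rs}^t=|\alpha r\cap\beta s^*|$ does not depend on $(\alpha,\beta)\in t$; here $\alpha r=\{\beta:(\alpha,\beta)\in r\}$. Elements of $S$ are basis relations, $c_{rs}^t$ intersection numbers. The valency of $s\in S$ is $n_s=|\alpha s|$. For $r,s\in S$, the complex product $rs\subseteq S$ is the set of basis relations contained in the composition $r\cdot s=\{(\alpha,\beta):\exists\gamma,(\alpha,\gamma)\in r,(\gamma,\beta)\in s\}$; for $X,Y\subseteq S$, $XY=\bigcup_{r\in X,s\in Y}rs$. The scheme is a $\{1,k\}$-scheme if every valency is $1$ or $k$ and both occur. Put $S_k=\{x\in S:n_x=k\}$. For $x,y\in S_k$ write $x\sim y$ if $c_{xs}^y=1$ for all $s\in x^*y$ (equivalently $|x^*y|=k$); this is a symmetric relation on $S_k$ (loops $x\sim x$ allowed). For $T\subseteq S$ put $N(T)=\{y\in S_k: y\sim x \text{ for all } x\in T\}$. The $\{1,k\}$-scheme is saturated if $N(T)\neq\varnothing$ for every $T\subseteq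 S$ with $|T|\le 4$. Given $x,y,z\in S_k$ and $r,s\in S$ with $x\sim z\sim y$, $r\in x^*z$, $s\in z^*y$ (an initial configuration), $r$ and $s$ are linked with respect to $(x,y,z)$ if there exist $q\in N(\{x,y,z\})$, $u,v,w\in S$ and $t\in rs$ such that $u\in x^*q$, $v\in y^*q$, $w\in z^*q$, and $x^*z\cap uw^*=\{r\}$, $z^*y\cap wv^*=\{s\}$, $x^*y\cap uv^*=\{t\}$. The $\{1,k\}$-scheme is Desarguesian if for every initial configuration $x,y,z,r,s$ the relations $r$ and $s$ are linked with respect to $(x,y,z)$. A scheme is schurian if there is a transitive permutation group $K\le\mathrm{Sym}(\Omega)$ such that $S$ is exactly the set of orbits of $K$ on $\Omega\times\Omega$. An algebraic isomorphism from $\mathcal{X}$ to a scheme $\mathcal{X}'=(\Omega',S')$ is a bijection $\varphi:S\to S'$ with $c_{rs}^t=c_{r^\varphi s^\varphi}^{t^\varphi}$ for all $r,s,t\in S$; $\mathcal{X}$ is separable if for every such $\varphi$ there exists a bijection $f:\Omega\to\Omega'$ with $r^f=r^\varphi$ for all $r\in S$. *)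

theory Defs
  imports "HOL-Library.Disjoint_Sets" "HOL-Algebra.Group_Action"
begin

definition association_scheme :: "'a set \<Rightarrow> 'a rel set \<Rightarrow> bool" where
  "association_scheme \<Omega> S \<longleftrightarrow>
     finite \<Omega> \<and> partition_on (\<Omega> \<times> \<Omega>) S \<and> Id_on \<Omega> \<in> S \<and> converse ` S = S \<and>
     (\<forall>r\<in>S. \<forall>s\<in>S. \<forall>t\<in>S. \<exists>n. \<forall>(\<alpha>, \<beta>)\<in>t. card (r `` {\<alpha>} \<inter> converse s `` {\<beta>}) = n)"

text \<open>In a scheme the numbers described by \<open>THE\<close> exist and are unique: basis relations are
  nonempty and the diagonal being one of them makes \<open>\<Omega>\<close> nonempty.\<close>

definition intersection_number :: "'a rel \<Rightarrow> 'a rel \<Rightarrow> 'a rel \<Rightarrow> nat" where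
  "intersection_number r s t =
     (THE n. \<forall>(\<alpha>, \<beta>)\<in>t. card (r `` {\<alpha>} \<inter> converse s `` {\<beta>}) = n)"

definition valency :: "'a set \<Rightarrow> 'a rel \<Rightarrow> nat" where
  "valency \<Omega> s = (THE n. \<forall>\<alpha>\<in>\<Omega>. card (s `` {\<alpha>}) = n)"

lemma intersection_number_eq:
  assumes "association_scheme \<Omega> S" "r \<in> S" "s \<in> S" "t \<in> S" "(\<alpha>, \<beta>) \<in> t"
  shows "intersection_number r s t = card (r `` {\<alpha>} \<inter> converse s `` {\<beta>})"
proof -
  have "\<forall>r\<in>S. \<forall>s\<in>S. \<forall>t\<in>S. \<exists>n. \<forall>(\<alpha>, \<beta>)\<in>t. card (r `` {\<alpha>} \<inter> converse s `` {\<beta>}) = n"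
    using assms(1) unfolding association_scheme_def by (elim conjE)
  then have "\<exists>n. \<forall>(\<alpha>, \<beta>)\<in>t. card (r `` {\<alpha>} \<inter> converse s `` {\<beta>}) = n"
    using assms(2-4) by (elim ballE) (assumption | contradiction)+
  then obtain n where n: "\<forall>(\<alpha>, \<beta>)\<in>t. card (r `` {\<alpha>} \<inter> converse s `` {\<beta>}) = n" ..
  have "intersection_number r s t = n"
    unfolding intersection_number_def
  proof (rule the_equality)
    show "\<forall>(\<alpha>, \<beta>)\<in>t. card (r `` {\<alpha>} \<inter> converse s `` {\<beta>}) = n" by (rule n)
  next
    fix m assume "\<forall>(\<alpha>, \<beta>)\<in>t. card (r `` {\<alpha>} \<inter> converse s `` {\<beta>}) = m"
    from bspec[OF this assms(5)] bspec[OF n assms(5)] show "m = n" by simp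
  qed
  then show ?thesis using bspec[OF n assms(5)] by simp
qed

lemma valency_eq:
  assumes "association_scheme \<Omega> S" "s \<in> S" "\<alpha> \<in> \<Omega>"
  shows "valency \<Omega> s = card (s `` {\<alpha>})"
proof -
  have d: "Id_on \<Omega> \<in> S" and c: "converse s \<in> S"
    using assms unfolding association_scheme_def by auto
  have "card (s `` {\<beta>}) = intersection_number s (converse s) (Id_on \<Omega>)" if "\<beta> \<in> \<Omega>" for \<beta>
    using intersection_number_eq[OF assms(1,2) c d, of \<beta> \<beta>] that by (simp add: Id_on_iff)
  then show ?thesis
    unfolding valency_def using assms(3) by (intro the_equality) auto
qed

definition complex_product :: "'a rel set \<Rightarrow> 'a rel \<Rightarrow> 'a rel \<Rightarrow> 'a rel set" where
  "complex_product S r s = {t \<in> S. t \<subseteq> r O s}"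

definition one_k_scheme :: "nat \<Rightarrow> 'a set \<Rightarrow> 'a rel set \<Rightarrow> bool" where
  "one_k_scheme k \<Omega> S \<longleftrightarrow> association_scheme \<Omega> S \<and> valency \<Omega> ` S = {1, k}"

definition rels_of_valency :: "nat \<Rightarrow> 'a set \<Rightarrow> 'a rel set \<Rightarrow> 'a rel set" where
  "rels_of_valency k \<Omega> S = {x \<in> S. valency \<Omega> x = k}"

definition sim :: "nat \<Rightarrow> 'a set \<Rightarrow> 'a rel set \<Rightarrow> 'a rel \<Rightarrow> 'a rel \<Rightarrow> bool" where
  "sim k \<Omega> S x y \<longleftrightarrow>
     x \<in> rels_of_valency k \<Omega> S \<and> y \<in> rels_of_valency k \<Omega> S \<and>
     (\<forall>s \<in> complex_product S (converse x) y. intersection_number x s y = 1)"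

definition nbrs :: "nat \<Rightarrow> 'a set \<Rightarrow> 'a rel set \<Rightarrow> 'a rel set \<Rightarrow> 'a rel set" where
  "nbrs k \<Omega> S T = {y \<in> rels_of_valency k \<Omega> S. \<forall>x\<in>T. sim k \<Omega> S y x}"

text \<open>The sets \<open>T\<close> range over sets of relations of valency \<open>k\<close>: \<open>sim\<close> relates only such
  relations, so \<open>nbrs\<close> is empty as soon as \<open>T\<close> contains a relation of valency 1 (such as the
  diagonal), and no scheme with \<open>k > 1\<close> would be saturated if these were allowed in \<open>T\<close>.\<close>

definition saturated :: "nat \<Rightarrow> 'a set \<Rightarrow> 'a rel set \<Rightarrow> bool" where
  "saturated k \<Omega> S \<longleftrightarrow>
     (\<forall>T \<subseteq> rels_of_valency k \<Omega> S. card T \<le> 4 \<longrightarrow> nbrs k \<Omega> S T \<noteq> {})"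

definition linked ::
    "nat \<Rightarrow> 'a set \<Rightarrow> 'a rel set \<Rightarrow> 'a rel \<Rightarrow> 'a rel \<Rightarrow> 'a rel \<Rightarrow> 'a rel \<Rightarrow> 'a rel \<Rightarrow> bool" where
  "linked k \<Omega> S x y z r s \<longleftrightarrow>
     (\<exists>q \<in> nbrs k \<Omega> S {x, y, z}. \<exists>u\<in>S. \<exists>v\<in>S. \<exists>w\<in>S. \<exists>t \<in> complex_product S r s.
        u \<in> complex_product S (converse x) q \<and>
        v \<in> complex_product S (converse y) q \<and>
        w \<in> complex_product S (converse z) q \<and>
        complex_product S (converse x) z \<inter> complex_product S u (converse w) = {r} \<and>
        complex_product S (converse z) y \<inter> complex_product S w (converse v) = {s} \<and>
        complex_product S (converse x) y \<inter> complex_product S u (converse v) = {t})"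

definition initial_configuration ::
    "nat \<Rightarrow> 'a set \<Rightarrow> 'a rel set \<Rightarrow> 'a rel \<Rightarrow> 'a rel \<Rightarrow> 'a rel \<Rightarrow> 'a rel \<Rightarrow> 'a rel \<Rightarrow> bool" where
  "initial_configuration k \<Omega> S x y z r s \<longleftrightarrow>
     x \<in> rels_of_valency k \<Omega> S \<and> y \<in> rels_of_valency k \<Omega> S \<and> z \<in> rels_of_valency k \<Omega> S \<and>
     r \<in> S \<and> s \<in> S \<and> sim k \<Omega> S x z \<and> sim k \<Omega> S z y \<and>
     r \<in> complex_product S (converse x) z \<and> s \<in> complex_product S (converse z) y"

definition desarguesian :: "nat \<Rightarrow> 'a set \<Rightarrow> 'a rel set \<Rightarrow> bool" where
  "desarguesian k \<Omega> S \<longleftrightarrow>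
     (\<forall>x y z r s. initial_configuration k \<Omega> S x y z r s \<longrightarrow> linked k \<Omega> S x y z r s)"

definition schurian :: "'a set \<Rightarrow> 'a rel set \<Rightarrow> bool" where
  "schurian \<Omega> S \<longleftrightarrow>
     (\<exists>K. subgroup K (BijGroup \<Omega>) \<and>
          transitive_action (BijGroup \<Omega>\<lparr>carrier := K\<rparr>) \<Omega> (\<lambda>g. g) \<and>
          S = orbits (BijGroup \<Omega>\<lparr>carrier := K\<rparr>) (\<Omega> \<times> \<Omega>) (\<lambda>g. map_prod g g))"

definition algebraic_isomorphism ::
    "'a rel set \<Rightarrow> 'b rel set \<Rightarrow> ('a rel \<Rightarrow> 'b rel) \<Rightarrow> bool" where
  "algebraic_isomorphism S S' \<phi> \<longleftrightarrow>
     bij_betw \<phi> S S' \<and>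
     (\<forall>r\<in>S. \<forall>s\<in>S. \<forall>t\<in>S. intersection_number r s t = intersection_number (\<phi> r) (\<phi> s) (\<phi> t))"

text \<open>The type argument is the type of the points of the second scheme, over which one cannot
  quantify inside a definition; separability is \<open>separable TYPE('b) \<Omega> S\<close> for all \<open>'b\<close>.\<close>

definition separable :: "'b itself \<Rightarrow> 'a set \<Rightarrow> 'a rel set \<Rightarrow> bool" where
  "separable (_ :: 'b itself) \<Omega> S \<longleftrightarrow>
     (\<forall>(\<Omega>' :: 'b set) S' \<phi>. association_scheme \<Omega>' S' \<and> algebraic_isomorphism S S' \<phi> \<longrightarrow>
        (\<exists>f. bij_betw f \<Omega> \<Omega>' \<and> (\<forall>r\<in>S. map_prod f f ` r = \<phi> r)))"

end

theory Submission
  imports Defs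
begin

text \<open>Fix a point \<open>\<alpha>\<close>. For \<open>x \<sim> y\<close> each \<open>s \<in> x\<^sup>*y\<close> induces a perfect matching between
  \<open>\<alpha>x\<close> and \<open>\<alpha>y\<close>. Linkedness says that the composition of the matchings of \<open>r\<close> and \<open>s\<close> lies
  inside one basis relation \<open>t\<close>, and \<open>t\<close> is determined by intersection numbers only. Hence, for an
  algebraic isomorphism \<open>\<phi>\<close> and points \<open>\<gamma> \<in> \<alpha>x\<close>, \<open>\<epsilon> \<in> \<alpha>z\<close>, \<open>\<delta> \<in> \<alpha>y\<close> with \<open>x \<sim> z \<sim> y\<close>, a pairing
  of points with points of the second scheme that respects \<open>\<phi>\<close> on \<open>(\<gamma>, \<epsilon>)\<close> and on \<open>(\<epsilon>, \<delta>)\<close> also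
  respects it on \<open>(\<gamma>, \<delta>)\<close>. Starting from one pair \<open>\<beta> \<mapsto> \<beta>'\<close> of points at valency \<open>k\<close>, one extends
  the pairing along two-step paths; saturation makes the result independent of the chosen path.
  The outcome is an isomorphism inducing \<open>\<phi>\<close> with prescribed images of two points. Separability is
  the existence of such an isomorphism, schurity the case where \<open>\<phi>\<close> is the identity.\<close>

section \<open>Points and basis relations\<close>

locale scheme =
  fixes \<Omega> :: "'a set" and S :: "'a rel set"
  assumes scheme: "association_scheme \<Omega> S"
begin

lemma partition: "partition_on (\<Omega> \<times> \<Omega>) S"
  and finite_points: "finite \<Omega>"
  and Id_on_basis: "Id_on \<Omega> \<in> S"
  using scheme by (simp_all add: association_scheme_def)

lemma converse_basis: "r \<in> S \<Longrightarrow> converse r \<in> S"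
  using scheme unfolding association_scheme_def by blast

lemma basis_subset: "r \<in> S \<Longrightarrow> r \<subseteq> \<Omega> \<times> \<Omega>"
  using partition unfolding partition_on_def by blast

lemma basis_points:
  assumes "r \<in> S" "(\<gamma>, \<delta>) \<in> r"
  shows "\<gamma> \<in> \<Omega>" "\<delta> \<in> \<Omega>"
  using basis_subset assms by blast+

lemma basis_nonempty: "r \<in> S \<Longrightarrow> \<exists>\<gamma> \<delta>. (\<gamma>, \<delta>) \<in> r"
  using partition unfolding partition_on_def by (metis equals0I surj_pair)

lemma basis_unique: "r \<in> S \<Longrightarrow> s \<in> S \<Longrightarrow> p \<in> r \<Longrightarrow> p \<in> s \<Longrightarrow> r = s"
  using partition unfolding partition_on_def disjoint_def by blast

lemma basis_exists: "\<gamma> \<in> \<Omega> \<Longrightarrow> \<delta> \<in> \<Omega> \<Longrightarrow> \<exists>t\<in>S. (\<gamma>, \<delta>) \<in> t"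
  using partition unfolding partition_on_def by blast

lemma finite_neighbours: "r \<in> S \<Longrightarrow> finite (r `` {\<alpha>})"
  by (rule finite_subset[OF _ finite_points]) (use basis_subset in blast)

section \<open>Complex products and triangles of points\<close>

lemma intersection_number_pos_iff:
  assumes "r \<in> S" "s \<in> S" "t \<in> S" "(\<gamma>, \<delta>) \<in> t"
  shows "intersection_number r s t > 0 \<longleftrightarrow> (\<exists>\<epsilon>. (\<gamma>, \<epsilon>) \<in> r \<and> (\<epsilon>, \<delta>) \<in> s)"
  using finite_neighbours[OF assms(1), of \<gamma>]
  by (auto simp: intersection_number_eq[OF scheme assms] card_gt_0_iff)

text \<open>Intersection numbers are constant on \<open>t\<close>, so one path through
  \<open>r\<close> and \<open>s\<close> over a single pair of \<open>t\<close> yields such a path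
  over every pair.\<close>

lemma complex_product_iff:
  assumes "r \<in> S" "s \<in> S" "t \<in> S" "(\<gamma>, \<delta>) \<in> t"
  shows "t \<in> complex_product S r s \<longleftrightarrow> (\<exists>\<epsilon>. (\<gamma>, \<epsilon>) \<in> r \<and> (\<epsilon>, \<delta>) \<in> s)"
proof
  assume "t \<in> complex_product S r s"
  then show "\<exists>\<epsilon>. (\<gamma>, \<epsilon>) \<in> r \<and> (\<epsilon>, \<delta>) \<in> s"
    using assms(4) unfolding complex_product_def by blast
next
  assume "\<exists>\<epsilon>. (\<gamma>, \<epsilon>) \<in> r \<and> (\<epsilon>, \<delta>) \<in> s"
  then have "intersection_number r s t > 0"
    using intersection_number_pos_iff[OF assms] by blast
  then have "t \<subseteq> r O s"
    using intersection_number_pos_iff[OF assms(1-3)] by (auto simp: relcomp_unfold)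
  then show "t \<in> complex_product S r s"
    using assms(3) by (simp add: complex_product_def)
qed

lemma complex_product_basis: "t \<in> complex_product S r s \<Longrightarrow> t \<in> S"
  by (simp add: complex_product_def)

lemma complex_product_iff_pos:
  assumes "r \<in> S" "s \<in> S"
  shows "t \<in> complex_product S r s \<longleftrightarrow> t \<in> S \<and> intersection_number r s t > 0"
  using basis_nonempty complex_product_iff[OF assms] intersection_number_pos_iff[OF assms]
  by (metis complex_product_basis)

lemma complex_product_triangle:
  assumes "x \<in> S" "y \<in> S" "s \<in> S" "(\<alpha>, \<gamma>) \<in> x" "(\<alpha>, \<delta>) \<in> y" "(\<gamma>, \<delta>) \<in> s"
  shows "s \<in> complex_product S (converse x) y"
  using complex_product_iff[OF converse_basis[OF assms(1)] assms(2,3,6)] assms(4,5) by blast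

lemma complex_product_converse:
  "s \<in> complex_product S (converse x) y \<Longrightarrow> s \<in> S \<Longrightarrow>
    converse s \<in> complex_product S (converse y) x"
  unfolding complex_product_def using converse_basis by blast

text \<open>A triangle with sides \<open>x\<close>, \<open>y\<close>, \<open>s\<close> exists
  somewhere. Read as positivity of the intersection number of \<open>y\<close> and
  \<open>converse s\<close> in \<open>x\<close>, this gives one over every pair of
  \<open>x\<close>.\<close>

lemma triangle_right:
  assumes "x \<in> S" "y \<in> S" "s \<in> complex_product S (converse x) y" "(\<alpha>, \<gamma>) \<in> x"
  obtains \<delta> where "(\<alpha>, \<delta>) \<in> y" "(\<gamma>, \<delta>) \<in> s"
proof -
  have s: "s \<in> S" using assms(3) by (rule complex_product_basis)
  obtain \<gamma>0 \<delta>0 where "(\<gamma>0, \<delta>0) \<in> s" using basis_nonempty[OF s] by blast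
  moreover from this obtain \<alpha>0 where "(\<alpha>0, \<gamma>0) \<in> x" "(\<alpha>0, \<delta>0) \<in> y"
    using assms(3) unfolding complex_product_def by blast
  ultimately have "intersection_number y (converse s) x > 0"
    using intersection_number_pos_iff[OF assms(2) converse_basis[OF s] assms(1)] by blast
  then show thesis
    using intersection_number_pos_iff[OF assms(2) converse_basis[OF s] assms(1,4)] that by blast
qed

lemma triangle_left:
  assumes "x \<in> S" "y \<in> S" "s \<in> complex_product S (converse x) y" "(\<alpha>, \<delta>) \<in> y"
  obtains \<gamma> where "(\<alpha>, \<gamma>) \<in> x" "(\<gamma>, \<delta>) \<in> s"
proof -
  note s = complex_product_basis[OF assms(3)]
  show thesis
    using triangle_right[OF assms(2,1) complex_product_converse[OF assms(3) s] assms(4)] that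
    by (metis converseD)
qed

section \<open>Similar relations and their matchings\<close>

lemma simD:
  assumes "sim k \<Omega> S x y"
  shows "x \<in> S" "y \<in> S" "valency \<Omega> x = k" "valency \<Omega> y = k"
  using assms by (auto simp: sim_def rels_of_valency_def)

text \<open>This is the injectivity of the matching induced by \<open>s\<close>: the points of
  \<alpha>x matched with \<delta> are counted by \<open>intersection_number x s y\<close>, which is
  1.\<close>

lemma sim_unique_left:
  assumes xy: "sim k \<Omega> S x y" and s: "s \<in> S"
    and "(\<alpha>, \<gamma>1) \<in> x" "(\<alpha>, \<gamma>2) \<in> x" "(\<alpha>, \<delta>) \<in> y" "(\<gamma>1, \<delta>) \<in> s" "(\<gamma>2, \<delta>) \<in> s"
  shows "\<gamma>1 = \<gamma>2"
proof -
  note x = simD(1)[OF xy] and y = simD(2)[OF xy]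
  have "s \<in> complex_product S (converse x) y"
    using complex_product_triangle[OF x y s] assms by blast
  then have "card (x `` {\<alpha>} \<inter> converse s `` {\<delta>}) = 1"
    using xy intersection_number_eq[OF scheme x s y assms(5)] by (simp add: sim_def)
  moreover have "\<gamma>1 \<in> x `` {\<alpha>} \<inter> converse s `` {\<delta>}" "\<gamma>2 \<in> x `` {\<alpha>} \<inter> converse s `` {\<delta>}"
    using assms by blast+
  ultimately show ?thesis by (metis card_1_singletonE singletonD)
qed

text \<open>In this form the valency is seen to be preserved by algebraic isomorphisms, once they
  preserve converses and the diagonal.\<close>

lemma valency_eq_intersection_number:
  assumes s: "s \<in> S"
  shows "valency \<Omega> s = intersection_number s (converse s) (Id_on \<Omega>)"
proof -
  obtain \<alpha> where \<alpha>: "\<alpha> \<in> \<Omega>" using basis_nonempty[OF Id_on_basis] by blast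
  show ?thesis
    using valency_eq[OF scheme s \<alpha>] \<alpha>
      intersection_number_eq[OF scheme s converse_basis[OF s] Id_on_basis, of \<alpha> \<alpha>]
    by (simp add: Id_on_iff)
qed

text \<open>Both products count the pairs of \<open>s\<close> between \<open>\<alpha>x\<close> and \<open>\<alpha>y\<close>.\<close>

lemma intersection_number_double_count:
  assumes x: "x \<in> S" and y: "y \<in> S" and s: "s \<in> S"
  shows "intersection_number x s y * valency \<Omega> y =
    intersection_number y (converse s) x * valency \<Omega> x"
proof -
  obtain \<alpha> where \<alpha>: "\<alpha> \<in> \<Omega>" using basis_nonempty[OF x] basis_points[OF x] by blast
  have "intersection_number x s y * valency \<Omega> y =
      (\<Sum>\<delta>\<in>y `` {\<alpha>}. card (x `` {\<alpha>} \<inter> converse s `` {\<delta>}))"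
    using valency_eq[OF scheme y \<alpha>]
    by (simp flip: intersection_number_eq[OF scheme x s y, of \<alpha>])
  also have "\<dots> = (\<Sum>\<delta>\<in>y `` {\<alpha>}. card {\<gamma> \<in> x `` {\<alpha>}. (\<gamma>, \<delta>) \<in> s})"
    by (intro sum.cong refl arg_cong[where f = card]) auto
  also have "\<dots> = (\<Sum>\<gamma>\<in>x `` {\<alpha>}. card {\<delta> \<in> y `` {\<alpha>}. (\<gamma>, \<delta>) \<in> s})"
    using sum_multicount_gen[of "y `` {\<alpha>}" "x `` {\<alpha>}" "\<lambda>\<delta> \<gamma>. (\<gamma>, \<delta>) \<in> s"]
      finite_neighbours x y by auto
  also have "\<dots> = (\<Sum>\<gamma>\<in>x `` {\<alpha>}. card (y `` {\<alpha>} \<inter> converse (converse s) `` {\<gamma>}))"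
    by (intro sum.cong refl arg_cong[where f = card]) auto
  also have "\<dots> = intersection_number y (converse s) x * valency \<Omega> x"
    using valency_eq[OF scheme x \<alpha>]
    by (simp del: converse_converse flip: intersection_number_eq[OF scheme y converse_basis[OF s] x, of \<alpha>])
  finally show ?thesis .
qed

text \<open>The definition of \<open>sim\<close> counts on one side only. As both valencies equal
  \<open>k\<close>, the double count carries the value 1 to the converse relation.\<close>

lemma sim_sym:
  assumes k: "k > 0" and xy: "sim k \<Omega> S x y"
  shows "sim k \<Omega> S y x"
proof -
  note x = simD(1)[OF xy] and y = simD(2)[OF xy]
  have "intersection_number y s x = 1" if s: "s \<in> complex_product S (converse y) x" for s
  proof -
    have sS: "s \<in> S" using s by (rule complex_product_basis)
    have "intersection_number x (converse s) y = 1"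
      using xy complex_product_converse[OF s sS] by (simp add: sim_def)
    then show ?thesis
      using intersection_number_double_count[OF y x sS] simD(3,4)[OF xy] k by simp
  qed
  then show ?thesis using xy by (simp add: sim_def)
qed

text \<open>From \<gamma> the relation \<open>u\<close> leads to a point \<kappa> of \<alpha>q, and
  \<open>w\<close>, \<open>v\<close> lead back from \<kappa> to points of \<alpha>z and \<alpha>y.
  The first two singleton intersections and the uniqueness in matchings identify these points with
  \<epsilon> and \<delta>; the third singleton then gives \<open>t\<close>. The conditions on
  relations use only complex products and \<open>sim\<close>, so the lemma applies in both schemes
  of an algebraic isomorphism.\<close>

lemma linked_triangle:
  assumes k: "k > 0" and xz: "sim k \<Omega> S x z" and zy: "sim k \<Omega> S z y"
    and q: "q \<in> S"
    and u: "u \<in> complex_product S (converse x) q"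
    and v: "v \<in> complex_product S (converse y) q"
    and w: "w \<in> complex_product S (converse z) q"
    and r: "complex_product S (converse x) z \<inter> complex_product S u (converse w) = {r}"
    and s: "complex_product S (converse z) y \<inter> complex_product S w (converse v) = {s}"
    and t: "complex_product S (converse x) y \<inter> complex_product S u (converse v) = {t}"
    and \<gamma>: "(\<alpha>, \<gamma>) \<in> x" and \<epsilon>: "(\<alpha>, \<epsilon>) \<in> z" and \<delta>: "(\<alpha>, \<delta>) \<in> y"
    and \<gamma>\<epsilon>: "(\<gamma>, \<epsilon>) \<in> r" and \<epsilon>\<delta>: "(\<epsilon>, \<delta>) \<in> s"
  shows "(\<gamma>, \<delta>) \<in> t"
proof -
  note S = simD(1,2)[OF xz] simD(2)[OF zy] q
  have uvw: "u \<in> S" "v \<in> S" "w \<in> S" using u v w by (auto dest: complex_product_basis)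
  \<comment> \<open>The relation containing (\<zeta>, \<eta>) lies in the first product because of
    \<alpha> and in the second because of \<kappa>, so it is the only common element
    \<open>c\<close>.\<close>
  have closing: "(\<zeta>, \<eta>) \<in> c"
    if a: "a \<in> S" "b \<in> S" "g \<in> S" "h \<in> S" "(\<alpha>, \<zeta>) \<in> a" "(\<alpha>, \<eta>) \<in> b" "(\<zeta>, \<kappa>) \<in> g" "(\<eta>, \<kappa>) \<in> h"
      "complex_product S (converse a) b \<inter> complex_product S g (converse h) = {c}"
    for a b c g h \<zeta> \<eta> \<kappa>
  proof -
    obtain d where d: "d \<in> S" "(\<zeta>, \<eta>) \<in> d"
      using basis_exists basis_points(2) a(1,2,5,6) by meson
    have "d \<in> complex_product S (converse a) b"
      using complex_product_triangle a d by blast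
    moreover have "d \<in> complex_product S g (converse h)"
      using complex_product_iff[OF a(3) converse_basis[OF a(4)] d] a by blast
    ultimately have "d = c" using a(9) by blast
    then show ?thesis using d by simp
  qed
  obtain \<kappa> where \<kappa>: "(\<alpha>, \<kappa>) \<in> q" "(\<gamma>, \<kappa>) \<in> u"
    using triangle_right[OF S(1) q u \<gamma>] .
  obtain \<epsilon>1 where \<epsilon>1: "(\<alpha>, \<epsilon>1) \<in> z" "(\<epsilon>1, \<kappa>) \<in> w"
    using triangle_left[OF S(2) q w \<kappa>(1)] .
  obtain \<delta>1 where \<delta>1: "(\<alpha>, \<delta>1) \<in> y" "(\<delta>1, \<kappa>) \<in> v"
    using triangle_left[OF S(3) q v \<kappa>(1)] .
  have rS: "r \<in> S" and sS: "s \<in> S" using equalityD2[OF r] equalityD2[OF s] by (simp_all add: complex_product_def)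
  have "(\<gamma>, \<epsilon>1) \<in> r" using closing[OF S(1,2) uvw(1,3) \<gamma> \<epsilon>1(1) \<kappa>(2) \<epsilon>1(2) r] .
  \<comment> \<open>The converse of \<open>r\<close> matches \<alpha>z with \<alpha>x, and both
    \<epsilon>1 and \<epsilon> are matched with \<gamma>.\<close>
  then have "\<epsilon>1 = \<epsilon>"
    using sim_unique_left[OF sim_sym[OF k xz] converse_basis[OF rS] \<epsilon>1(1) \<epsilon> \<gamma>] \<gamma>\<epsilon> by blast
  then have "(\<epsilon>, \<delta>1) \<in> s" using closing[OF S(2,3) uvw(3,2) \<epsilon> \<delta>1(1) _ \<delta>1(2) s] \<epsilon>1(2) by simp
  then have "\<delta>1 = \<delta>"
    using sim_unique_left[OF sim_sym[OF k zy] converse_basis[OF sS] \<delta>1(1) \<delta> \<epsilon>] \<epsilon>\<delta> by blast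
  then show ?thesis using closing[OF S(1,3) uvw(1,2) \<gamma> \<delta>1(1) \<kappa>(2) \<delta>1(2) t] by simp
qed

end

section \<open>Algebraic isomorphisms\<close>

locale scheme_iso = source: scheme \<Omega> S + target: scheme \<Omega>' S'
  for \<Omega> :: "'a set" and S :: "'a rel set" and \<Omega>' :: "'b set" and S' :: "'b rel set" +
  fixes \<phi> :: "'a rel \<Rightarrow> 'b rel"
  assumes iso: "algebraic_isomorphism S S' \<phi>"
begin

section \<open>Notions preserved by an algebraic isomorphism\<close>

lemma iso_bij: "bij_betw \<phi> S S'"
  and iso_intersection_number: "r \<in> S \<Longrightarrow> s \<in> S \<Longrightarrow> t \<in> S \<Longrightarrow>
    intersection_number (\<phi> r) (\<phi> s) (\<phi> t) = intersection_number r s t"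
  using iso by (simp_all add: algebraic_isomorphism_def)

lemma iso_basis: "r \<in> S \<Longrightarrow> \<phi> r \<in> S'"
  using iso_bij by (auto simp: bij_betw_def)

lemma iso_inj: "r \<in> S \<Longrightarrow> s \<in> S \<Longrightarrow> \<phi> r = \<phi> s \<Longrightarrow> r = s"
  using iso_bij by (auto simp: bij_betw_def inj_on_def)

lemma iso_surj: "r' \<in> S' \<Longrightarrow> \<exists>r\<in>S. r' = \<phi> r"
  using iso_bij by (auto simp: bij_betw_def)

text \<open>Membership in a complex product is positivity of an intersection number, which \<phi>
  keeps.\<close>

lemma iso_complex_product:
  assumes "r \<in> S" "s \<in> S"
  shows "complex_product S' (\<phi> r) (\<phi> s) = \<phi> ` complex_product S r s"
proof -
  have "t' \<in> complex_product S' (\<phi> r) (\<phi> s) \<longleftrightarrow> t' \<in> \<phi> ` complex_product S r s" for t'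
    using target.complex_product_iff_pos[OF iso_basis[OF assms(1)] iso_basis[OF assms(2)], of t']
      source.complex_product_iff_pos[OF assms] iso_intersection_number[OF assms]
      iso_basis iso_surj[of t'] by (force simp: image_iff)
  then show ?thesis by blast
qed

text \<open>Multiplication by the diagonal of \<open>\<Omega>'\<close> changes nothing. Pulled back
  to \<open>e\<close>, the preimage of that diagonal, this puts the diagonal of
  \<open>\<Omega>\<close> into its own product with \<open>e\<close>, so \<open>e\<close> contains a
  diagonal pair.\<close>

lemma iso_Id_on: "\<phi> (Id_on \<Omega>) = Id_on \<Omega>'"
proof -
  obtain e where e: "e \<in> S" "\<phi> e = Id_on \<Omega>'"
    using iso_surj[OF target.Id_on_basis] by auto
  note I = source.Id_on_basis
  have "\<phi> (Id_on \<Omega>) \<in> complex_product S' (\<phi> (Id_on \<Omega>)) (Id_on \<Omega>')"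
    using iso_basis[OF I] target.basis_subset[OF iso_basis[OF I]]
    by (fastforce simp: complex_product_def)
  then have "\<phi> (Id_on \<Omega>) \<in> \<phi> ` complex_product S (Id_on \<Omega>) e"
    using iso_complex_product[OF I e(1)] e(2) by simp
  then have "Id_on \<Omega> \<in> complex_product S (Id_on \<Omega>) e"
    using iso_inj I source.complex_product_basis by (metis imageE)
  moreover obtain \<alpha> where "(\<alpha>, \<alpha>) \<in> Id_on \<Omega>" using source.basis_nonempty[OF I] by blast
  ultimately have "(\<alpha>, \<alpha>) \<in> e"
    unfolding complex_product_def by blast
  then show ?thesis using source.basis_unique[OF I e(1)] \<open>(\<alpha>, \<alpha>) \<in> Id_on \<Omega>\<close> e(2) by auto
qed

text \<open>Among basis relations, \<open>converse r\<close> is the only one whose product with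
  \<open>r\<close> contains the diagonal; \<phi> preserves products and the diagonal.\<close>

lemma iso_converse:
  assumes r: "r \<in> S"
  shows "\<phi> (converse r) = converse (\<phi> r)"
proof -
  note I = source.Id_on_basis and c = source.converse_basis[OF r]
  obtain \<gamma> \<delta> where \<gamma>\<delta>: "(\<gamma>, \<delta>) \<in> r" using source.basis_nonempty[OF r] by blast
  then have "(\<gamma>, \<gamma>) \<in> Id_on \<Omega>" using source.basis_points[OF r] by blast
  then have "Id_on \<Omega> \<in> complex_product S r (converse r)"
    using source.complex_product_iff[OF r c I] \<gamma>\<delta> by blast
  then have "Id_on \<Omega>' \<in> complex_product S' (\<phi> r) (\<phi> (converse r))"
    using iso_complex_product[OF r c] iso_Id_on by (metis imageI)
  moreover obtain \<gamma>' where "(\<gamma>', \<gamma>') \<in> Id_on \<Omega>'"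
    using target.basis_nonempty[OF target.Id_on_basis] by blast
  ultimately obtain \<delta>' where "(\<gamma>', \<delta>') \<in> \<phi> r" "(\<delta>', \<gamma>') \<in> \<phi> (converse r)"
    unfolding complex_product_def by blast
  then show ?thesis
    using target.basis_unique iso_basis[OF c] target.converse_basis[OF iso_basis[OF r]]
    by blast
qed

lemma iso_valency:
  assumes r: "r \<in> S"
  shows "valency \<Omega>' (\<phi> r) = valency \<Omega> r"
proof -
  show ?thesis
    using source.valency_eq_intersection_number[OF r]
      target.valency_eq_intersection_number[OF iso_basis[OF r]]
      iso_intersection_number[OF r source.converse_basis[OF r] source.Id_on_basis]
    by (simp add: iso_converse[OF r] iso_Id_on)
qed

lemma iso_sim:
  assumes xy: "sim k \<Omega> S x y"
  shows "sim k \<Omega>' S' (\<phi> x) (\<phi> y)"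
proof -
  note x = source.simD(1)[OF xy] and y = source.simD(2)[OF xy]
  have "intersection_number (\<phi> x) s' (\<phi> y) = 1"
    if "s' \<in> complex_product S' (converse (\<phi> x)) (\<phi> y)" for s'
  proof -
    have "s' \<in> \<phi> ` complex_product S (converse x) y"
      using that iso_complex_product[OF source.converse_basis[OF x] y] iso_converse[OF x] by simp
    then obtain s where s: "s \<in> complex_product S (converse x) y" "s' = \<phi> s" by blast
    then show ?thesis
      using xy iso_intersection_number[OF x source.complex_product_basis[OF s(1)] y]
      by (simp add: sim_def)
  qed
  then show ?thesis
    using source.simD[OF xy] iso_basis iso_valency by (simp add: sim_def rels_of_valency_def)
qed

text \<open>Injectivity of \<phi> on \<open>S\<close> lets images commute with intersections, so the
  singleton conditions of linkedness pass to the target.\<close>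

lemma iso_complex_product_Int:
  assumes "a \<in> S" "b \<in> S" "g \<in> S" "h \<in> S"
    and "complex_product S (converse a) b \<inter> complex_product S g (converse h) = {c}"
  shows "complex_product S' (converse (\<phi> a)) (\<phi> b) \<inter>
    complex_product S' (\<phi> g) (converse (\<phi> h)) = {\<phi> c}"
proof -
  have "\<phi> ` complex_product S (converse a) b \<inter> \<phi> ` complex_product S g (converse h) =
      \<phi> ` (complex_product S (converse a) b \<inter> complex_product S g (converse h))"
    using iso_inj source.complex_product_basis by (auto simp: image_iff) blast
  then show ?thesis
    using assms iso_complex_product source.converse_basis
    by (simp flip: iso_converse)
qed

section \<open>Pairings of points that respect \<phi>\<close>

definition compatible :: "'a \<Rightarrow> 'a \<Rightarrow> 'b \<Rightarrow> 'b \<Rightarrow> bool" where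
  "compatible \<gamma> \<delta> \<gamma>' \<delta>' \<longleftrightarrow> (\<exists>t\<in>S. (\<gamma>, \<delta>) \<in> t \<and> (\<gamma>', \<delta>') \<in> \<phi> t)"

lemma compatible_sym: "compatible \<gamma> \<delta> \<gamma>' \<delta>' \<Longrightarrow> compatible \<delta> \<gamma> \<delta>' \<gamma>'"
  unfolding compatible_def using source.converse_basis iso_converse by (metis converseI)

lemma compatible_basis:
  assumes "compatible \<gamma> \<delta> \<gamma>' \<delta>'" "t \<in> S" "(\<gamma>, \<delta>) \<in> t"
  shows "(\<gamma>', \<delta>') \<in> \<phi> t"
  using assms source.basis_unique unfolding compatible_def by blast

text \<open>The image of a basis relation is the diagonal exactly when the relation is. One
  direction makes a compatible map injective, the other shows that a point has only one
  partner.\<close>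

lemma compatible_eq_iff:
  assumes "compatible \<gamma> \<delta> \<gamma>' \<delta>'"
  shows "\<gamma> = \<delta> \<longleftrightarrow> \<gamma>' = \<delta>'"
proof -
  obtain t where t: "t \<in> S" "(\<gamma>, \<delta>) \<in> t" "(\<gamma>', \<delta>') \<in> \<phi> t"
    using assms unfolding compatible_def by blast
  have "\<gamma> = \<delta> \<longleftrightarrow> t = Id_on \<Omega>"
    using source.basis_unique[OF t(1) source.Id_on_basis t(2)] source.basis_points[OF t(1,2)] t(2)
    by auto
  also have "\<dots> \<longleftrightarrow> \<phi> t = Id_on \<Omega>'"
    using iso_inj[OF t(1) source.Id_on_basis] iso_Id_on by auto
  also have "\<dots> \<longleftrightarrow> \<gamma>' = \<delta>'"
    using target.basis_unique[OF iso_basis[OF t(1)] target.Id_on_basis t(3)]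
      target.basis_points[OF iso_basis[OF t(1)] t(3)] t(3) by auto
  finally show ?thesis .
qed

text \<open>The relation from \<gamma> to \<delta> lies in the product of \<open>converse x\<close>
  and \<open>y\<close>; its image lies in the corresponding product, so the triangle can be copied
  starting from the given side in the target.\<close>

lemma compatible_extend:
  assumes x: "x \<in> S" and y: "y \<in> S"
    and \<gamma>: "(\<alpha>, \<gamma>) \<in> x" "(\<alpha>', \<gamma>') \<in> \<phi> x" and \<delta>: "(\<alpha>, \<delta>) \<in> y"
  obtains \<delta>' where "(\<alpha>', \<delta>') \<in> \<phi> y" "compatible \<gamma> \<delta> \<gamma>' \<delta>'"
proof -
  obtain s where s: "s \<in> S" "(\<gamma>, \<delta>) \<in> s"
    using source.basis_exists source.basis_points x y \<gamma> \<delta> by meson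
  then have "s \<in> complex_product S (converse x) y"
    using source.complex_product_triangle x y \<gamma> \<delta> by blast
  then have "\<phi> s \<in> complex_product S' (converse (\<phi> x)) (\<phi> y)"
    using iso_complex_product[OF source.converse_basis[OF x] y] iso_converse[OF x] by auto
  then show thesis
    using target.triangle_right[OF iso_basis[OF x] iso_basis[OF y] _ \<gamma>(2)] that s
    unfolding compatible_def by blast
qed

text \<open>The image of \<open>s\<close> again has valency 1, so the point supplied by
  \<open>compatible_extend\<close> can only be \<open>\<sigma>'\<close>.\<close>

lemma thin_compatible:
  assumes s: "s \<in> S" "valency \<Omega> s = 1" and x: "x \<in> S"
    and \<sigma>: "(\<alpha>, \<sigma>) \<in> s" "(\<alpha>', \<sigma>') \<in> \<phi> s" and \<gamma>: "(\<alpha>, \<gamma>) \<in> x" "(\<alpha>', \<gamma>') \<in> \<phi> x"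
  shows "compatible \<sigma> \<gamma> \<sigma>' \<gamma>'"
proof -
  obtain \<sigma>1 where \<sigma>1: "(\<alpha>', \<sigma>1) \<in> \<phi> s" "compatible \<gamma> \<sigma> \<gamma>' \<sigma>1"
    using compatible_extend[OF x s(1) \<gamma> \<sigma>(1)] .
  have "card (\<phi> s `` {\<alpha>'}) = 1"
    using valency_eq[OF target.scheme iso_basis[OF s(1)], of \<alpha>'] iso_valency[OF s(1)] s(2)
      target.basis_points(1)[OF iso_basis[OF s(1)] \<sigma>(2)] by simp
  then have "\<sigma>1 = \<sigma>'" using \<sigma>1(1) \<sigma>(2) by (metis Image_singleton_iff card_1_singletonE singletonD)
  then show ?thesis using \<sigma>1(2) compatible_sym by blast
qed

text \<open>Such a map is injective and sends neighbourhoods into neighbourhoods. Equal valencies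
  turn these inclusions into equalities, and since the neighbourhoods of \<open>f \<alpha>\<close>
  cover \<open>\<Omega>'\<close>, the map is onto.\<close>

lemma compatible_map_isomorphism:
  assumes dom: "f ` \<Omega> \<subseteq> \<Omega>'"
    and compat: "\<And>\<gamma> \<delta>. \<gamma> \<in> \<Omega> \<Longrightarrow> \<delta> \<in> \<Omega> \<Longrightarrow> compatible \<gamma> \<delta> (f \<gamma>) (f \<delta>)"
  shows "bij_betw f \<Omega> \<Omega>' \<and> (\<forall>r\<in>S. map_prod f f ` r = \<phi> r)"
proof -
  have inj: "inj_on f \<Omega>"
    using compat compatible_eq_iff by (meson inj_onI)
  have neighbours: "f ` (r `` {\<gamma>}) = \<phi> r `` {f \<gamma>}" if r: "r \<in> S" and \<gamma>: "\<gamma> \<in> \<Omega>" for r \<gamma>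
  proof (rule card_subset_eq)
    show "finite (\<phi> r `` {f \<gamma>})" by (rule target.finite_neighbours[OF iso_basis[OF r]])
    show "f ` (r `` {\<gamma>}) \<subseteq> \<phi> r `` {f \<gamma>}"
      using compatible_basis compat r \<gamma> source.basis_points(2) by blast
    have "r `` {\<gamma>} \<subseteq> \<Omega>" using source.basis_subset[OF r] by blast
    then have "card (f ` (r `` {\<gamma>})) = card (r `` {\<gamma>})"
      by (intro card_image inj_on_subset[OF inj])
    also have "\<dots> = card (\<phi> r `` {f \<gamma>})"
      using valency_eq[OF source.scheme r \<gamma>] iso_valency[OF r]
        valency_eq[OF target.scheme iso_basis[OF r], of "f \<gamma>"] dom \<gamma> by auto
    finally show "card (f ` (r `` {\<gamma>})) = card (\<phi> r `` {f \<gamma>})" .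
  qed
  obtain \<alpha> where \<alpha>: "\<alpha> \<in> \<Omega>" using source.basis_nonempty[OF source.Id_on_basis] by blast
  have "\<delta>' \<in> f ` \<Omega>" if \<delta>': "\<delta>' \<in> \<Omega>'" for \<delta>'
  proof -
    obtain r where r: "r \<in> S" "(f \<alpha>, \<delta>') \<in> \<phi> r"
      using target.basis_exists[of "f \<alpha>" \<delta>'] iso_surj \<delta>' dom \<alpha> by (metis imageI subsetD)
    then show ?thesis using neighbours[OF r(1) \<alpha>] source.basis_subset[OF r(1)] by blast
  qed
  then have image: "f ` \<Omega> = \<Omega>'" using dom by blast
  have "map_prod f f ` r = \<phi> r" if r: "r \<in> S" for r
  proof
    show "map_prod f f ` r \<subseteq> \<phi> r"
    proof clarsimp
      fix \<gamma> \<delta> assume "(\<gamma>, \<delta>) \<in> r"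
      then show "(f \<gamma>, f \<delta>) \<in> \<phi> r"
        using compatible_basis[OF compat r] source.basis_points[OF r] by blast
    qed
    show "\<phi> r \<subseteq> map_prod f f ` r"
    proof (rule subrelI)
      fix \<gamma>' \<delta>' assume *: "(\<gamma>', \<delta>') \<in> \<phi> r"
      then obtain \<gamma> where \<gamma>: "\<gamma> \<in> \<Omega>" "\<gamma>' = f \<gamma>"
        using image target.basis_points(1)[OF iso_basis[OF r]] by blast
      then have "\<delta>' \<in> f ` (r `` {\<gamma>})" using neighbours[OF r \<gamma>(1)] * by blast
      then show "(\<gamma>', \<delta>') \<in> map_prod f f ` r" using \<gamma> by force
    qed
  qed
  then show ?thesis using inj image by (simp add: bij_betw_def)
qed

end

section \<open>Extending a pairing of points\<close>

locale desarguesian_iso = scheme_iso \<Omega> S \<Omega>' S' \<phi>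
  for \<Omega> :: "'a set" and S :: "'a rel set" and \<Omega>' :: "'b set" and S' :: "'b rel set" and \<phi> +
  fixes k :: nat
  assumes k: "k > 1"
    and valencies: "valency \<Omega> ` S = {1, k}"
    and saturated: "saturated k \<Omega> S"
    and desarguesian: "desarguesian k \<Omega> S"
begin

abbreviation similar (infix "\<sim>" 50) where "x \<sim> y \<equiv> sim k \<Omega> S x y"

lemma similar_sym: "x \<sim> y \<Longrightarrow> y \<sim> x"
  using source.sim_sym k by simp

text \<open>This is saturation for four relations, repetitions allowed.\<close>

lemma similar_common:
  assumes "{a, b, c, d} \<subseteq> rels_of_valency k \<Omega> S"
  obtains p where "p \<sim> a" "p \<sim> b" "p \<sim> c" "p \<sim> d"
proof -
  have "card {a, b, c, d} \<le> 4"
    using card_length[of "[a, b, c, d]"] by simp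
  then have "nbrs k \<Omega> S {a, b, c, d} \<noteq> {}"
    using saturated assms unfolding saturated_def by blast
  then show thesis using that by (auto simp: nbrs_def)
qed

lemma similar_valency: "x \<sim> y \<Longrightarrow> x \<in> rels_of_valency k \<Omega> S \<and> y \<in> rels_of_valency k \<Omega> S"
  by (simp add: sim_def)

text \<open>The Desarguesian condition is available in the source. The relations \<open>q\<close>,
  \<open>u\<close>, \<open>v\<close>, \<open>w\<close> that link \<open>r\<close> and
  \<open>s\<close> there are carried over by \<phi>, and \<open>linked_triangle\<close> in both
  schemes yields corresponding relations \<open>t\<close> and \<open>\<phi> t\<close>.\<close>

lemma compatible_trans:
  assumes xz: "x \<sim> z" and zy: "z \<sim> y"
    and \<gamma>: "(\<alpha>, \<gamma>) \<in> x" "(\<alpha>', \<gamma>') \<in> \<phi> x"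
    and \<epsilon>: "(\<alpha>, \<epsilon>) \<in> z" "(\<alpha>', \<epsilon>') \<in> \<phi> z"
    and \<delta>: "(\<alpha>, \<delta>) \<in> y" "(\<alpha>', \<delta>') \<in> \<phi> y"
    and \<gamma>\<epsilon>: "compatible \<gamma> \<epsilon> \<gamma>' \<epsilon>'" and \<epsilon>\<delta>: "compatible \<epsilon> \<delta> \<epsilon>' \<delta>'"
  shows "compatible \<gamma> \<delta> \<gamma>' \<delta>'"
proof -
  note x = source.simD(1)[OF xz] and z = source.simD(2)[OF xz] and y = source.simD(2)[OF zy]
  obtain r where r: "r \<in> S" "(\<gamma>, \<epsilon>) \<in> r" "(\<gamma>', \<epsilon>') \<in> \<phi> r"
    using \<gamma>\<epsilon> unfolding compatible_def by blast
  obtain s where s: "s \<in> S" "(\<epsilon>, \<delta>) \<in> s" "(\<epsilon>', \<delta>') \<in> \<phi> s"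
    using \<epsilon>\<delta> unfolding compatible_def by blast
  have "initial_configuration k \<Omega> S x y z r s"
    using source.complex_product_triangle[OF x z r(1) \<gamma>(1) \<epsilon>(1) r(2)]
      source.complex_product_triangle[OF z y s(1) \<epsilon>(1) \<delta>(1) s(2)]
      xz zy r(1) s(1) similar_valency unfolding initial_configuration_def by blast
  then have "linked k \<Omega> S x y z r s"
    using desarguesian unfolding desarguesian_def by blast
  then obtain q u v w t where
    q: "q \<in> nbrs k \<Omega> S {x, y, z}" and uvw: "u \<in> S" "v \<in> S" "w \<in> S"
    and t: "t \<in> complex_product S r s"
    and u: "u \<in> complex_product S (converse x) q"
    and v: "v \<in> complex_product S (converse y) q"
    and w: "w \<in> complex_product S (converse z) q"
    and r_eq: "complex_product S (converse x) z \<inter> complex_product S u (converse w) = {r}"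
    and s_eq: "complex_product S (converse z) y \<inter> complex_product S w (converse v) = {s}"
    and t_eq: "complex_product S (converse x) y \<inter> complex_product S u (converse v) = {t}"
    unfolding linked_def by (elim bexE conjE) (rule that; assumption)
  have q: "q \<in> S" using q by (auto simp: nbrs_def rels_of_valency_def)
  have k0: "k > 0" using k by simp
  have transfer: "\<phi> g \<in> complex_product S' (converse (\<phi> a)) (\<phi> q)"
    if "a \<in> S" "g \<in> complex_product S (converse a) q" for a g
    using iso_complex_product[OF source.converse_basis[OF that(1)] q] that iso_converse by auto
  have "(\<gamma>, \<delta>) \<in> t"
    using source.linked_triangle[OF k0 xz zy q u v w r_eq s_eq t_eq \<gamma>(1) \<epsilon>(1) \<delta>(1) r(2) s(2)] .
  moreover have "(\<gamma>', \<delta>') \<in> \<phi> t"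
    using target.linked_triangle[OF k0 iso_sim[OF xz] iso_sim[OF zy] iso_basis[OF q]
        transfer[OF x u] transfer[OF y v] transfer[OF z w]
        iso_complex_product_Int[OF x z uvw(1,3) r_eq] iso_complex_product_Int[OF z y uvw(3,2) s_eq]
        iso_complex_product_Int[OF x y uvw(1,2) t_eq] \<gamma>(2) \<epsilon>(2) \<delta>(2) r(3) s(3)] .
  ultimately show ?thesis
    using source.complex_product_basis[OF t] unfolding compatible_def by blast
qed

end

section \<open>The pairing grown from one base pair\<close>

locale based_iso = desarguesian_iso \<Omega> S \<Omega>' S' \<phi> k
  for \<Omega> :: "'a set" and S :: "'a rel set" and \<Omega>' :: "'b set" and S' :: "'b rel set" and \<phi> k +
  fixes b :: "'a rel" and \<alpha> \<beta> :: 'a and \<alpha>' \<beta>' :: 'b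
  assumes b: "b \<in> rels_of_valency k \<Omega> S"
    and \<beta>: "(\<alpha>, \<beta>) \<in> b" "(\<alpha>', \<beta>') \<in> \<phi> b"
begin

abbreviation over :: "'a rel \<Rightarrow> 'a \<Rightarrow> 'b \<Rightarrow> bool" where
  "over y \<delta> \<delta>' \<equiv> (\<alpha>, \<delta>) \<in> y \<and> (\<alpha>', \<delta>') \<in> \<phi> y"

text \<open>A relation \<open>y\<close> of valency \<open>k\<close> may fail to be similar to
  \<open>b\<close>, so \<delta> is reached from \<beta> through a point over some \<open>z\<close>
  similar to both.\<close>

definition paired_via :: "'a rel \<Rightarrow> 'a rel \<Rightarrow> 'a \<Rightarrow> 'b \<Rightarrow> bool" where
  "paired_via z y \<delta> \<delta>' \<longleftrightarrow> z \<sim> b \<and> z \<sim> y \<and> over y \<delta> \<delta>' \<and>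
     (\<exists>\<epsilon> \<epsilon>'. over z \<epsilon> \<epsilon>' \<and> compatible \<beta> \<epsilon> \<beta>' \<epsilon>' \<and> compatible \<epsilon> \<delta> \<epsilon>' \<delta>')"

text \<open>Similarity never involves relations of valency 1; over these the partner of a point is
  already determined by \<open>\<alpha>'\<close>.\<close>

definition paired :: "'a \<Rightarrow> 'b \<Rightarrow> bool" where
  "paired \<delta> \<delta>' \<longleftrightarrow> (\<exists>y z. paired_via z y \<delta> \<delta>') \<or> (\<exists>s\<in>S. valency \<Omega> s = 1 \<and> over s \<delta> \<delta>')"

lemma basis_point: "x \<in> S \<Longrightarrow> \<exists>\<gamma>. (\<alpha>, \<gamma>) \<in> x"
proof -
  assume x: "x \<in> S"
  have b': "b \<in> S" using b by (simp add: rels_of_valency_def)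
  have "card (x `` {\<alpha>}) = valency \<Omega> x"
    using valency_eq[OF source.scheme x source.basis_points(1)[OF b' \<beta>(1)]] by simp
  moreover have "valency \<Omega> x \<in> {1, k}" using valencies x by blast
  ultimately have "x `` {\<alpha>} \<noteq> {}" using k by force
  then show ?thesis by blast
qed

text \<open>The old intermediate point \<epsilon> determines the new one: \<open>\<pi>'\<close> is
  chosen so that \<epsilon> and \<pi> are paired compatibly. Transitivity along \<open>b\<close>,
  \<open>z\<close>, \<open>p\<close> and along \<open>p\<close>, \<open>z\<close>, \<open>y\<close>
  does the rest.\<close>

lemma paired_via_change:
  assumes via: "paired_via z y \<delta> \<delta>'" and p: "p \<sim> b" "p \<sim> z" "p \<sim> y"
  shows "paired_via p y \<delta> \<delta>'"
proof -
  obtain \<epsilon> \<epsilon>' where \<epsilon>: "over z \<epsilon> \<epsilon>'" "compatible \<beta> \<epsilon> \<beta>' \<epsilon>'" "compatible \<epsilon> \<delta> \<epsilon>' \<delta>'"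
    and z: "z \<sim> b" "z \<sim> y" and \<delta>: "over y \<delta> \<delta>'"
    using via unfolding paired_via_def by blast
  obtain \<pi> where \<pi>: "(\<alpha>, \<pi>) \<in> p" using basis_point[OF source.simD(1)[OF p(1)]] by blast
  obtain \<pi>' where \<pi>': "(\<alpha>', \<pi>') \<in> \<phi> p" "compatible \<epsilon> \<pi> \<epsilon>' \<pi>'"
    using compatible_extend[OF source.simD(1)[OF z(1)] source.simD(1)[OF p(1)] _ _ \<pi>] \<epsilon>(1) by blast
  have "compatible \<beta> \<pi> \<beta>' \<pi>'"
    using compatible_trans[OF similar_sym[OF z(1)] similar_sym[OF p(2)]] \<beta> \<epsilon> \<pi> \<pi>' by blast
  moreover have "compatible \<pi> \<delta> \<pi>' \<delta>'"
    using compatible_trans[OF p(2) z(2)] \<delta> \<epsilon> \<pi> \<pi>' compatible_sym by blast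
  ultimately show ?thesis
    unfolding paired_via_def using p \<delta> \<pi> \<pi>' by blast
qed

text \<open>Both paths are rerouted through similar relations \<open>p\<close> and \<open>q\<close>.
  Transitivity along \<open>p\<close>, \<open>b\<close>, \<open>q\<close>, then along
  \<open>p\<close>, \<open>q\<close>, \<open>w\<close>, and finally along \<open>y\<close>,
  \<open>p\<close>, \<open>w\<close> connects \<delta> with \<eta>.\<close>

lemma paired_via_compatible:
  assumes \<delta>: "paired_via z y \<delta> \<delta>'" and \<eta>: "paired_via v w \<eta> \<eta>'"
  shows "compatible \<delta> \<eta> \<delta>' \<eta>'"
proof -
  have sims: "z \<sim> b" "z \<sim> y" "v \<sim> b" "v \<sim> w" using \<delta> \<eta> unfolding paired_via_def by blast+
  \<comment> \<open>Similarity to \<open>b\<close>, \<open>y\<close>, \<open>z\<close> reroutes the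
    first path; similarity to \<open>w\<close> serves the last application of transitivity.\<close>
  obtain p where p: "p \<sim> b" "p \<sim> y" "p \<sim> z" "p \<sim> w"
    using similar_common[of b y z w] similar_valency sims by blast
  \<comment> \<open>Four relations are already used up for \<open>p\<close>, which may fail to be
    similar to \<open>v\<close>. So the second path receives its own \<open>q\<close>, tied to
    \<open>p\<close>.\<close>
  obtain q where q: "q \<sim> b" "q \<sim> w" "q \<sim> v" "q \<sim> p"
    using similar_common[of b w v p] similar_valency sims p by blast
  obtain \<pi> \<pi>' where \<pi>: "over p \<pi> \<pi>'" "compatible \<beta> \<pi> \<beta>' \<pi>'" "compatible \<pi> \<delta> \<pi>' \<delta>'"
    and y: "over y \<delta> \<delta>'"
    using paired_via_change[OF \<delta> p(1,3,2)] unfolding paired_via_def by blast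
  obtain \<kappa> \<kappa>' where \<kappa>: "over q \<kappa> \<kappa>'" "compatible \<beta> \<kappa> \<beta>' \<kappa>'" "compatible \<kappa> \<eta> \<kappa>' \<eta>'"
    and w: "over w \<eta> \<eta>'"
    using paired_via_change[OF \<eta> q(1,3,2)] unfolding paired_via_def by blast
  have "compatible \<pi> \<kappa> \<pi>' \<kappa>'"
    using compatible_trans[OF p(1) similar_sym[OF q(1)]] \<beta> \<pi> \<kappa> compatible_sym by blast
  then have "compatible \<pi> \<eta> \<pi>' \<eta>'"
    using compatible_trans[OF similar_sym[OF q(4)] q(2)] \<pi> \<kappa> w by blast
  then show ?thesis
    using compatible_trans[OF similar_sym[OF p(2)] p(4)] \<pi> y w compatible_sym by blast
qed

lemma paired_over: "paired \<delta> \<delta>' \<Longrightarrow> \<exists>y\<in>S. over y \<delta> \<delta>'"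
  unfolding paired_def paired_via_def using source.simD(2) by blast

lemma paired_compatible:
  assumes \<delta>: "paired \<delta> \<delta>'" and \<eta>: "paired \<eta> \<eta>'"
  shows "compatible \<delta> \<eta> \<delta>' \<eta>'"
proof -
  obtain y w where y: "y \<in> S" "over y \<delta> \<delta>'" and w: "w \<in> S" "over w \<eta> \<eta>'"
    using paired_over \<delta> \<eta> by meson
  consider "\<exists>y z v w. paired_via z y \<delta> \<delta>' \<and> paired_via v w \<eta> \<eta>'"
    | "\<exists>s\<in>S. valency \<Omega> s = 1 \<and> over s \<delta> \<delta>'" | "\<exists>s\<in>S. valency \<Omega> s = 1 \<and> over s \<eta> \<eta>'"
    using \<delta> \<eta> unfolding paired_def by blast
  then show ?thesis
  proof cases
    case 1
    then show ?thesis using paired_via_compatible by blast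
  next
    case 2
    then show ?thesis using thin_compatible w by blast
  next
    case 3
    then show ?thesis using thin_compatible y compatible_sym by blast
  qed
qed

lemma paired_exists:
  assumes \<delta>: "\<delta> \<in> \<Omega>"
  obtains \<delta>' where "paired \<delta> \<delta>'"
proof -
  have b': "b \<in> S" using b by (simp add: rels_of_valency_def)
  obtain y where y: "y \<in> S" "(\<alpha>, \<delta>) \<in> y"
    using source.basis_exists source.basis_points(1)[OF b' \<beta>(1)] \<delta> by blast
  show thesis
  proof (cases "valency \<Omega> y = 1")
    case True
    obtain \<delta>' where "(\<alpha>', \<delta>') \<in> \<phi> y" using compatible_extend[OF b' y(1) \<beta> y(2)] by blast
    then have "paired \<delta> \<delta>'" using True y unfolding paired_def by blast
    then show ?thesis by (rule that)
  next
    case False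
    then have "y \<in> rels_of_valency k \<Omega> S"
      using valencies y(1) by (auto simp: rels_of_valency_def)
    then obtain z where z: "z \<sim> b" "z \<sim> y"
      using similar_common[of b y b y] b by blast
    note zS = source.simD(1)[OF z(1)]
    obtain \<epsilon> where \<epsilon>: "(\<alpha>, \<epsilon>) \<in> z" using basis_point[OF zS] by blast
    obtain \<epsilon>' where \<epsilon>': "(\<alpha>', \<epsilon>') \<in> \<phi> z" "compatible \<beta> \<epsilon> \<beta>' \<epsilon>'"
      using compatible_extend[OF b' zS \<beta> \<epsilon>] .
    obtain \<delta>' where "(\<alpha>', \<delta>') \<in> \<phi> y" "compatible \<epsilon> \<delta> \<epsilon>' \<delta>'"
      using compatible_extend[OF zS y(1) \<epsilon> \<epsilon>'(1) y(2)] .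
    then show ?thesis
      using that z y \<epsilon> \<epsilon>' unfolding paired_def paired_via_def by blast
  qed
qed

text \<open>The path runs from \<beta> to an intermediate point and back. This makes the final map
  take the prescribed value at \<beta>.\<close>

lemma paired_base: "paired \<beta> \<beta>'"
proof -
  have b': "b \<in> S" using b by (simp add: rels_of_valency_def)
  obtain z where z: "z \<sim> b" using similar_common[of b b b b] b by blast
  note zS = source.simD(1)[OF z]
  obtain \<epsilon> where \<epsilon>: "(\<alpha>, \<epsilon>) \<in> z" using basis_point[OF zS] by blast
  obtain \<epsilon>' where "(\<alpha>', \<epsilon>') \<in> \<phi> z" "compatible \<beta> \<epsilon> \<beta>' \<epsilon>'"
    using compatible_extend[OF b' zS \<beta> \<epsilon>] .
  then show ?thesis
    using z \<beta> \<epsilon> compatible_sym unfolding paired_def paired_via_def by blast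
qed

lemma paired_thin: "s \<in> S \<Longrightarrow> valency \<Omega> s = 1 \<Longrightarrow> over s \<delta> \<delta>' \<Longrightarrow> paired \<delta> \<delta>'"
  unfolding paired_def by blast

lemma paired_isomorphism:
  "\<exists>f. bij_betw f \<Omega> \<Omega>' \<and> (\<forall>r\<in>S. map_prod f f ` r = \<phi> r) \<and>
     (\<forall>\<delta> \<delta>'. paired \<delta> \<delta>' \<longrightarrow> f \<delta> = \<delta>')"
proof -
  define f where "f \<delta> = (SOME \<delta>'. paired \<delta> \<delta>')" for \<delta>
  have f: "paired \<delta> (f \<delta>)" if "\<delta> \<in> \<Omega>" for \<delta>
    using paired_exists[OF that] unfolding f_def by (metis someI)
  have "f ` \<Omega> \<subseteq> \<Omega>'"
    using f paired_over iso_basis target.basis_points(2) by (metis image_subsetI)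
  then have "bij_betw f \<Omega> \<Omega>' \<and> (\<forall>r\<in>S. map_prod f f ` r = \<phi> r)"
    by (rule compatible_map_isomorphism) (intro paired_compatible f)
  moreover have "f \<delta> = \<delta>'" if "paired \<delta> \<delta>'" for \<delta> \<delta>'
  proof -
    have "paired \<delta> (f \<delta>)" using that unfolding f_def by (rule someI)
    \<comment> \<open>Compatibility of \<delta> with itself makes its two partners coincide.\<close>
    then show ?thesis using paired_compatible[OF _ that] compatible_eq_iff by blast
  qed
  ultimately show ?thesis by blast
qed

end

section \<open>Isomorphisms with two prescribed images\<close>

context desarguesian_iso
begin

text \<open>If \<open>r\<close> has valency \<open>k\<close>, the pair itself is the base pair. If
  \<open>r\<close> has valency 1, a base pair over any relation of valency \<open>k\<close> will do,
  because points over relations of valency 1 have forced images; the last clause of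
  \<open>base\<close> records this.\<close>

lemma two_point_isomorphism:
  assumes r: "r \<in> S" "(\<alpha>, \<beta>) \<in> r" "(\<alpha>', \<beta>') \<in> \<phi> r"
  shows "\<exists>f. bij_betw f \<Omega> \<Omega>' \<and> (\<forall>r\<in>S. map_prod f f ` r = \<phi> r) \<and> f \<alpha> = \<alpha>' \<and> f \<beta> = \<beta>'"
proof -
  have \<alpha>: "\<alpha> \<in> \<Omega>" and \<alpha>': "\<alpha>' \<in> \<Omega>'"
    using source.basis_points(1)[OF r(1,2)] target.basis_points(1)[OF iso_basis[OF r(1)] r(3)] .
  have base: "\<exists>f. bij_betw f \<Omega> \<Omega>' \<and> (\<forall>r\<in>S. map_prod f f ` r = \<phi> r) \<and> f \<alpha> = \<alpha>' \<and> f \<gamma> = \<gamma>' \<and>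
      (\<forall>s\<in>S. \<forall>\<delta> \<delta>'. valency \<Omega> s = 1 \<and> (\<alpha>, \<delta>) \<in> s \<and> (\<alpha>', \<delta>') \<in> \<phi> s \<longrightarrow> f \<delta> = \<delta>')"
    if b: "b \<in> rels_of_valency k \<Omega> S" "(\<alpha>, \<gamma>) \<in> b" "(\<alpha>', \<gamma>') \<in> \<phi> b" for b \<gamma> \<gamma>'
  proof -
    interpret based_iso \<Omega> S \<Omega>' S' \<phi> k b \<alpha> \<gamma> \<alpha>' \<gamma>' by unfold_locales (use b in auto)
    have "valency \<Omega> (Id_on \<Omega>) = 1"
      using valency_eq[OF source.scheme source.Id_on_basis \<alpha>] \<alpha> by simp
    \<comment> \<open>The diagonal has valency 1, so the centre itself is covered by the
      pairing.\<close>
    then have "paired \<alpha> \<alpha>'"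
      using paired_thin[OF source.Id_on_basis] \<alpha> \<alpha>' iso_Id_on by auto
    then show ?thesis using paired_isomorphism paired_base paired_thin by metis
  qed
  show ?thesis
  proof (cases "valency \<Omega> r = k")
    case True
    then show ?thesis using base[of r \<beta> \<beta>'] r unfolding rels_of_valency_def by blast
  next
    case False
    then have "valency \<Omega> r = 1" using valencies r(1) by blast
    obtain b where b: "b \<in> S" "valency \<Omega> b = k" using valencies by (metis imageE insertCI)
    have "b `` {\<alpha>} \<noteq> {}"
      using valency_eq[OF source.scheme b(1) \<alpha>] b(2) k by force
    moreover have "\<phi> b `` {\<alpha>'} \<noteq> {}"
      using valency_eq[OF target.scheme iso_basis[OF b(1)] \<alpha>'] iso_valency b k by force
    ultimately obtain \<gamma> \<gamma>' where "(\<alpha>, \<gamma>) \<in> b" "(\<alpha>', \<gamma>') \<in> \<phi> b" by blast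
    then show ?thesis
      using base[of b \<gamma> \<gamma>'] b r \<open>valency \<Omega> r = 1\<close> unfolding rels_of_valency_def by blast
  qed
qed

end

section \<open>Schurity\<close>

text \<open>The group is the automorphism group \<open>K\<close>. It preserves each basis relation,
  and the assumption makes each a single orbit; for the diagonal this is transitivity.\<close>

lemma (in scheme) schurian_if_two_point_homogeneous:
  assumes two_point: "\<And>r \<alpha> \<beta> \<alpha>' \<beta>'. r \<in> S \<Longrightarrow> (\<alpha>, \<beta>) \<in> r \<Longrightarrow> (\<alpha>', \<beta>') \<in> r \<Longrightarrow>
    \<exists>f. bij_betw f \<Omega> \<Omega> \<and> (\<forall>r\<in>S. map_prod f f ` r = r) \<and> f \<alpha> = \<alpha>' \<and> f \<beta> = \<beta>'"
  shows "schurian \<Omega> S"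
proof -
  define K where "K = {g \<in> Bij \<Omega>. \<forall>r\<in>S. map_prod g g ` r = r}"
  interpret B: group "BijGroup \<Omega>" by (rule group_BijGroup)
  \<comment> \<open>Inclusion is enough, since an injective map of the finite set \<open>r\<close>
    into itself is onto.\<close>
  have K_iff: "g \<in> K \<longleftrightarrow> g \<in> Bij \<Omega> \<and>
      (\<forall>r\<in>S. \<forall>\<gamma>\<in>\<Omega>. \<forall>\<delta>\<in>\<Omega>. (\<gamma>, \<delta>) \<in> r \<longrightarrow> (g \<gamma>, g \<delta>) \<in> r)" for g
  proof
    assume g: "g \<in> K"
    have "(g \<gamma>, g \<delta>) \<in> r" if "r \<in> S" "(\<gamma>, \<delta>) \<in> r" for r \<gamma> \<delta>
      using g that map_prod_imageI[OF that(2), of g g] by (simp add: K_def)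
    then show "g \<in> Bij \<Omega> \<and> (\<forall>r\<in>S. \<forall>\<gamma>\<in>\<Omega>. \<forall>\<delta>\<in>\<Omega>. (\<gamma>, \<delta>) \<in> r \<longrightarrow> (g \<gamma>, g \<delta>) \<in> r)"
      using g by (simp add: K_def)
  next
    assume g: "g \<in> Bij \<Omega> \<and> (\<forall>r\<in>S. \<forall>\<gamma>\<in>\<Omega>. \<forall>\<delta>\<in>\<Omega>. (\<gamma>, \<delta>) \<in> r \<longrightarrow> (g \<gamma>, g \<delta>) \<in> r)"
    have "map_prod g g ` r = r" if r: "r \<in> S" for r
    proof (rule card_subset_eq)
      show "finite r" using basis_subset[OF r] finite_points by (meson finite_SigmaI finite_subset)
      show "map_prod g g ` r \<subseteq> r" using g r basis_points[OF r] by auto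
      have "inj_on (map_prod g g) (\<Omega> \<times> \<Omega>)"
        using g by (intro map_prod_inj_on) (auto simp: Bij_def bij_betw_def)
      then show "card (map_prod g g ` r) = card r"
        using basis_subset[OF r] by (intro card_image) (rule inj_on_subset)
    qed
    then show "g \<in> K" using g unfolding K_def by blast
  qed
  have sub: "subgroup K (BijGroup \<Omega>)"
  proof (rule B.subgroupI)
    show "K \<subseteq> carrier (BijGroup \<Omega>)" by (auto simp: K_def BijGroup_def)
    have "(\<lambda>x\<in>\<Omega>. x) \<in> K" by (simp add: K_iff id_Bij)
    then show "K \<noteq> {}" by blast
  next
    fix g assume g: "g \<in> K"
    have gB: "g \<in> Bij \<Omega>" using g by (simp add: K_def)
    have bij: "bij_betw g \<Omega> \<Omega>" using gB by (simp add: Bij_def)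
    have "(inv_into \<Omega> g \<gamma>, inv_into \<Omega> g \<delta>) \<in> r" if r: "r \<in> S" "(\<gamma>, \<delta>) \<in> r" for r \<gamma> \<delta>
    proof -
      \<comment> \<open>The equality in the definition of \<open>K\<close> supplies preimages inside
        \<open>r\<close>.\<close>
      have "(\<gamma>, \<delta>) \<in> map_prod g g ` r" using g r unfolding K_def by blast
      then obtain \<gamma>0 \<delta>0 where "(\<gamma>0, \<delta>0) \<in> r" "\<gamma> = g \<gamma>0" "\<delta> = g \<delta>0" by auto
      then show ?thesis
        using basis_points[OF r(1)] bij by (metis bij_betw_inv_into_left)
    qed
    then show "inv\<^bsub>BijGroup \<Omega>\<^esub> g \<in> K"
      using restrict_inv_into_Bij[OF gB] by (simp add: inv_BijGroup[OF gB] K_iff)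
  next
    fix g h assume gh: "g \<in> K" "h \<in> K"
    then have B: "g \<in> Bij \<Omega>" "h \<in> Bij \<Omega>" by (simp_all add: K_def)
    have "compose \<Omega> g h \<in> K"
      using gh compose_Bij[OF B] Bij_imp_funcset[OF B(2)]
      by (auto simp: K_iff compose_eq Pi_iff)
    then show "g \<otimes>\<^bsub>BijGroup \<Omega>\<^esub> h \<in> K" using B by (simp add: BijGroup_def)
  qed
  have homogeneous: "\<exists>g\<in>K. g \<alpha> = \<alpha>' \<and> g \<beta> = \<beta>'"
    if r: "r \<in> S" "(\<alpha>, \<beta>) \<in> r" "(\<alpha>', \<beta>') \<in> r" for r \<alpha> \<beta> \<alpha>' \<beta>'
  proof -
    obtain f where f: "bij_betw f \<Omega> \<Omega>" "\<forall>r\<in>S. map_prod f f ` r = r" "f \<alpha> = \<alpha>'" "f \<beta> = \<beta>'"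
      using two_point[OF r] by blast
    \<comment> \<open>Elements of \<open>Bij \<Omega>\<close> are extensional, hence the
      restriction.\<close>
    have "restrict f \<Omega> \<in> Bij \<Omega>" using f(1) by (simp add: Bij_def)
    then have "restrict f \<Omega> \<in> K" using f(2) by (auto simp: K_iff)
    then show ?thesis using f(3,4) basis_points[OF r(1,2)] by (metis restrict_apply')
  qed
  have "transitive_action (BijGroup \<Omega>\<lparr>carrier := K\<rparr>) \<Omega> (\<lambda>g. g)"
  proof (intro transitive_action.intro group_action.intro transitive_action_axioms.intro)
    show "group_hom (BijGroup \<Omega>\<lparr>carrier := K\<rparr>) (BijGroup \<Omega>) (\<lambda>g. g)"
      using B.canonical_inj_is_hom[OF sub] by (simp add: id_def)
    show "\<exists>g\<in>carrier (BijGroup \<Omega>\<lparr>carrier := K\<rparr>). g \<alpha> = \<alpha>'" if "\<alpha> \<in> \<Omega>" "\<alpha>' \<in> \<Omega>" for \<alpha> \<alpha>'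
      using homogeneous[OF Id_on_basis, of \<alpha> \<alpha> \<alpha>' \<alpha>'] that by auto
  qed
  moreover have "S = orbits (BijGroup \<Omega>\<lparr>carrier := K\<rparr>) (\<Omega> \<times> \<Omega>) (\<lambda>g. map_prod g g)"
  proof -
    have orbit: "orbit (BijGroup \<Omega>\<lparr>carrier := K\<rparr>) (\<lambda>g. map_prod g g) (\<gamma>, \<delta>) = r"
      if r: "r \<in> S" "(\<gamma>, \<delta>) \<in> r" for r \<gamma> \<delta>
    proof
      show "orbit (BijGroup \<Omega>\<lparr>carrier := K\<rparr>) (\<lambda>g. map_prod g g) (\<gamma>, \<delta>) \<subseteq> r"
        using r basis_points[OF r] by (auto simp: orbit_def K_iff)
      show "r \<subseteq> orbit (BijGroup \<Omega>\<lparr>carrier := K\<rparr>) (\<lambda>g. map_prod g g) (\<gamma>, \<delta>)"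
        using homogeneous[OF r] by (fastforce simp: orbit_def)
    qed
    show ?thesis
    proof (intro equalityI subsetI)
      fix r assume r: "r \<in> S"
      then obtain \<gamma> \<delta> where "(\<gamma>, \<delta>) \<in> r" using basis_nonempty by blast
      then show "r \<in> orbits (BijGroup \<Omega>\<lparr>carrier := K\<rparr>) (\<Omega> \<times> \<Omega>) (\<lambda>g. map_prod g g)"
        using orbit[OF r] basis_points[OF r] unfolding orbits_def by blast
    next
      fix c assume "c \<in> orbits (BijGroup \<Omega>\<lparr>carrier := K\<rparr>) (\<Omega> \<times> \<Omega>) (\<lambda>g. map_prod g g)"
      then obtain \<gamma> \<delta> where "\<gamma> \<in> \<Omega>" "\<delta> \<in> \<Omega>"
        "c = orbit (BijGroup \<Omega>\<lparr>carrier := K\<rparr>) (\<lambda>g. map_prod g g) (\<gamma>, \<delta>)"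
        unfolding orbits_def by blast
      then show "c \<in> S" using orbit basis_exists[of \<gamma> \<delta>] by auto
    qed
  qed
  ultimately show ?thesis using sub unfolding schurian_def by blast
qed

section \<open>Schurity and separability from two-point isomorphisms\<close>

theorem theorem1p1:
  fixes k :: nat and \<Omega> :: "'a set" and S :: "'a rel set"
  assumes "k > 1"
    and "one_k_scheme k \<Omega> S"
    and "saturated k \<Omega> S"
    and "desarguesian k \<Omega> S"
  shows "schurian \<Omega> S \<and> separable TYPE('b) \<Omega> S"
proof
  have scheme: "association_scheme \<Omega> S" and valencies: "valency \<Omega> ` S = {1, k}"
    using assms(2) by (simp_all add: one_k_scheme_def)
  interpret scheme \<Omega> S by unfold_locales (rule scheme)
  show "schurian \<Omega> S"
  proof (rule schurian_if_two_point_homogeneous)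
    \<comment> \<open>Automorphisms are the isomorphisms that induce the identity of
      \<open>S\<close>.\<close>
    interpret id: desarguesian_iso \<Omega> S \<Omega> S "\<lambda>r. r" k
      by unfold_locales (use assms valencies in \<open>simp_all add: algebraic_isomorphism_def bij_betw_def\<close>)
    show "\<exists>f. bij_betw f \<Omega> \<Omega> \<and> (\<forall>r\<in>S. map_prod f f ` r = r) \<and> f \<alpha> = \<alpha>' \<and> f \<beta> = \<beta>'"
      if "r \<in> S" "(\<alpha>, \<beta>) \<in> r" "(\<alpha>', \<beta>') \<in> r" for r \<alpha> \<beta> \<alpha>' \<beta>'
      using id.two_point_isomorphism[OF that] .
  qed
  show "separable TYPE('b) \<Omega> S"
    unfolding separable_def
  proof (intro allI impI, elim conjE)
    fix \<Omega>' :: "'b set" and S' \<phi>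
    assume scheme': "association_scheme \<Omega>' S'" and iso: "algebraic_isomorphism S S' \<phi>"
    interpret desarguesian_iso \<Omega> S \<Omega>' S' \<phi> k
      by unfold_locales (use assms valencies scheme' iso in simp_all)
    \<comment> \<open>Separability prescribes no images of points, so any pair of the diagonal and
      any pair of its image can be used.\<close>
    obtain \<alpha> \<beta> where "(\<alpha>, \<beta>) \<in> Id_on \<Omega>" using basis_nonempty[OF Id_on_basis] by blast
    moreover obtain \<alpha>' \<beta>' where "(\<alpha>', \<beta>') \<in> \<phi> (Id_on \<Omega>)"
      using target.basis_nonempty[OF iso_basis[OF Id_on_basis]] by blast
    ultimately show "\<exists>f. bij_betw f \<Omega> \<Omega>' \<and> (\<forall>r\<in>S. map_prod f f ` r = \<phi> r)"
      using two_point_isomorphism[OF Id_on_basis] by blast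
  qed
qed

end
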